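(* Let $N\ge 1$ be an integer and let $f(\alpha_s,\beta_s;\alpha_q,\beta_q)$ denote the correlation between the ULA codeword $\mathbf{w}_s=\mathbf{b}^*(\alpha_s,\beta_s)$ and the normalized near-field channel vector $\mathbf{b}(\alpha_q,\beta_q)$, as defined in the context. Then the correlation depends only on the differences $\delta_\alpha=\alpha_q-\alpha_s$ and $\delta_\beta=\beta_q-\beta_s$, and not on the codeword: for any two codewords $\mathbf{w}_s=\mathbf{b}^*(\alpha_s,\beta_s)$ and $\mathbf{w}_{s'}=\mathbf{b}^*(\alpha_{s'},\beta_{s'})$ and any displacements $\delta_\alpha,\delta_\beta$, $$f(\alpha_s,\beta_s;\alpha_s+\delta_\alpha,\beta_s+\delta_\beta)=f(\alpha_{s'},\beta_{s'};\alpha_{s'}+\delta_\alpha,\beta_{s'}+\delta_\beta).$$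
   Context: Setting: a uniform linear array (ULA) of $N$ antennas with wavelength $\lambda>0$, spacing $d=\lambda/2$, wavenumber $k=2\pi/\lambda$, and antenna coordinates $y_n=\left(n-\frac{N+1}{2}\right)d$, $n=1,\dots,N$. A user at distance $r$ and angle $\theta$ from the array center has distance $r_n$ to the $n$-th antenna, for which the second-order (Fresnel) expression $r_n=r-\sin\theta\,y_n+\frac{\cos^2\theta}{2r}y_n^2$ is used throughout. The near-field beam focusing vector (normalized channel vector) is $$\mathbf{b}(r,\theta)=\frac{1}{\sqrt N}\left[e^{-jk(r_1-r)},\dots,e^{-jk(r_N-r)}\right]^T,\qquad j=\sqrt{-1}.$$ Transform-domain coordinates: $\alpha=\frac{\lambda\cos^2\theta}{4r}$ and $\beta=\sin\theta$. In these coordinates the vector is written $\mathbf{b}(\alpha,\beta)$, whose $n$-th entry is $\frac{1}{\sqrt N}\exp\left(-j\frac{2\pi}{\lambda}\left(-\beta y_n+\frac{2}{\lambda}\alpha y_n^2\right)\right)$; this formula makes sense for all real $\alpha,\beta$. A codeword is a vector $\mathbf{w}_s=\mathbf{b}^*(\alpha_s,\beta_s)$, where $^*$ denotes entrywise complex conjugation. The correlation between the codeword $\mathbf{w}_s$ and the channel vector $\mathbf{b}(\alpha_q,\beta_q)$ is $$f(\alpha_s,\beta_s;\alpha_q,\beta_q)=\left|\mathbf{b}(\alpha_q,\beta_q)^T\,\mathbf{b}^*(\alpha_s,\beta_s)\right|.$$ *)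

theory Defs
  imports Complex_Main "Jordan_Normal_Form.Matrix"
begin

text \<open>Antennas are numbered \<open>n = 1, \<dots>, N\<close>, vector entries \<open>i = 0, \<dots>, N - 1\<close>; entry \<open>i\<close> of a
  vector belongs to antenna \<open>n = i + 1\<close>. The parameter \<open>lam\<close> is the wavelength.\<close>

definition spacing :: "real \<Rightarrow> real" where
  "spacing lam = lam / 2"

definition wavenumber :: "real \<Rightarrow> real" where
  "wavenumber lam = 2 * pi / lam"

definition antenna_coord :: "nat \<Rightarrow> real \<Rightarrow> nat \<Rightarrow> real" where
  "antenna_coord N lam n = (real n - (real N + 1) / 2) * spacing lam"

definition fresnel_dist :: "nat \<Rightarrow> real \<Rightarrow> real \<Rightarrow> real \<Rightarrow> nat \<Rightarrow> real" where
  "fresnel_dist N lam r \<theta> n =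
     r - sin \<theta> * antenna_coord N lam n + (cos \<theta>)\<^sup>2 / (2 * r) * (antenna_coord N lam n)\<^sup>2"

definition polar_focusing_vec :: "nat \<Rightarrow> real \<Rightarrow> real \<Rightarrow> real \<Rightarrow> complex vec" where
  "polar_focusing_vec N lam r \<theta> =
     complex_of_real (1 / sqrt (real N)) \<cdot>\<^sub>v
     vec N (\<lambda>i. exp (- \<i> * complex_of_real
       (wavenumber lam * (fresnel_dist N lam r \<theta> (i + 1) - r))))"

definition focusing_vec :: "nat \<Rightarrow> real \<Rightarrow> real \<Rightarrow> real \<Rightarrow> complex vec" where
  "focusing_vec N lam \<alpha> \<beta> =
     complex_of_real (1 / sqrt (real N)) \<cdot>\<^sub>v
     vec N (\<lambda>i. exp (- \<i> * complex_of_real (2 * pi / lam *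
       (- \<beta> * antenna_coord N lam (i + 1) + 2 / lam * \<alpha> * (antenna_coord N lam (i + 1))\<^sup>2))))"

lemma polar_focusing_vec_eq_focusing_vec:
  assumes "lam > 0" "r > 0"
  shows "polar_focusing_vec N lam r \<theta> =
    focusing_vec N lam (lam * (cos \<theta>)\<^sup>2 / (4 * r)) (sin \<theta>)"
proof -
  have "fresnel_dist N lam r \<theta> n - r =
      - sin \<theta> * antenna_coord N lam n +
      2 / lam * (lam * (cos \<theta>)\<^sup>2 / (4 * r)) * (antenna_coord N lam n)\<^sup>2" for n
    using assms by (simp add: fresnel_dist_def)
  then show ?thesis
    by (simp only: polar_focusing_vec_def focusing_vec_def wavenumber_def)
qed

definition codeword :: "nat \<Rightarrow> real \<Rightarrow> real \<Rightarrow> real \<Rightarrow> complex vec" where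
  "codeword N lam \<alpha> \<beta> = conjugate (focusing_vec N lam \<alpha> \<beta>)"

text \<open>The scalar product \<open>\<bullet>\<close> is bilinear (no conjugation), i.e. \<open>v \<bullet> w\<close> is the matrix product of
  the transpose of \<open>v\<close> with \<open>w\<close>.\<close>

definition correlation :: "nat \<Rightarrow> real \<Rightarrow> real \<Rightarrow> real \<Rightarrow> real \<Rightarrow> real \<Rightarrow> real" where
  "correlation N lam \<alpha>s \<beta>s \<alpha>q \<beta>q = cmod (focusing_vec N lam \<alpha>q \<beta>q \<bullet> codeword N lam \<alpha>s \<beta>s)"

end

theory Submission
  imports Defs
begin

text \<open>Every entry is a common real factor times a unit complex number whose phase is linear in
  (\<alpha>, \<beta>). Conjugating the codeword negates its phase, so in each term of the scalar
  product the two phases combine into the phase at the coordinate differences. The sum therefore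
  sees only these differences, and the codeword can be moved to the origin:
  \<open>correlation_eq_diff\<close>.\<close>

text \<open>The phase of each entry is linear in \<open>(\<alpha>, \<beta>)\<close>, so multiplying a channel entry by the
  conjugate codeword entry subtracts the coordinates.\<close>

lemma correlation_eq_diff:
  "correlation N lam \<alpha>s \<beta>s \<alpha>q \<beta>q = correlation N lam 0 0 (\<alpha>q - \<alpha>s) (\<beta>q - \<beta>s)"
proof -
  define p where "p \<alpha> \<beta> i = 2 * pi / lam *
      (- \<beta> * antenna_coord N lam (i + 1) + 2 / lam * \<alpha> * (antenna_coord N lam (i + 1))\<^sup>2)"
    for \<alpha> \<beta> i
  define c where "c = complex_of_real (1 / sqrt (real N))"
  have exp_cis: "exp (- \<i> * complex_of_real x) = cis (- x)" for x
    by (simp add: cis_conv_exp)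
  have focusing: "focusing_vec N lam \<alpha> \<beta> = c \<cdot>\<^sub>v vec N (\<lambda>i. cis (- p \<alpha> \<beta> i))" for \<alpha> \<beta>
    by (simp only: focusing_vec_def p_def c_def exp_cis)
  have cnj_c: "cnj c = c"
    by (simp add: c_def)
  have p_diff: "p (\<alpha> - \<alpha>') (\<beta> - \<beta>') i = p \<alpha> \<beta> i - p \<alpha>' \<beta>' i" for \<alpha> \<alpha>' \<beta> \<beta>' i
    by (simp add: p_def algebra_simps diff_divide_distrib add_divide_distrib)
  have entry: "c * cis (- x) * (c * cis y) = c * c * cis (- (x - y))" for x y
    using cis_mult [of "- x" y] by (simp add: mult_ac)
  have scalar: "focusing_vec N lam \<alpha> \<beta> \<bullet> codeword N lam \<alpha>' \<beta>' =
      (\<Sum>i = 0..<N. c * c * cis (- p (\<alpha> - \<alpha>') (\<beta> - \<beta>') i))" for \<alpha> \<beta> \<alpha>' \<beta>'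
    \<comment> \<open>The target sum is split back into products of a channel entry and a conjugated
      codeword entry, so that both sides agree term by term.\<close>
    unfolding p_diff entry [symmetric]
    by (simp add: codeword_def focusing scalar_prod_def cnj_c cis_cnj)
  show ?thesis
    \<comment> \<open>\<open>scalar\<close> rewrites both sides; on the right the codeword sits at
      (0, 0), so subtracting its coordinates changes nothing.\<close>
    by (simp add: correlation_def scalar)
qed

theorem mainTheorem1:
  fixes N :: nat and lam :: real
  assumes "N \<ge> 1" and "lam > 0"
  shows "(\<exists>g :: real \<Rightarrow> real \<Rightarrow> real. \<forall>\<alpha>s \<beta>s \<alpha>q \<beta>q :: real.
            correlation N lam \<alpha>s \<beta>s \<alpha>q \<beta>q = g (\<alpha>q - \<alpha>s) (\<beta>q - \<beta>s)) \<and>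
         (\<forall>\<alpha>s \<beta>s \<alpha>s' \<beta>s' \<delta>\<alpha> \<delta>\<beta> :: real.
            correlation N lam \<alpha>s \<beta>s (\<alpha>s + \<delta>\<alpha>) (\<beta>s + \<delta>\<beta>) =
            correlation N lam \<alpha>s' \<beta>s' (\<alpha>s' + \<delta>\<alpha>) (\<beta>s' + \<delta>\<beta>))"
proof (intro conjI exI allI)
  \<comment> \<open>The witness for \<open>g\<close> is \<open>correlation N lam 0 0\<close>, the
    correlation with the codeword at the origin.\<close>
  fix \<alpha>s \<beta>s \<alpha>q \<beta>q :: real
  show "correlation N lam \<alpha>s \<beta>s \<alpha>q \<beta>q = correlation N lam 0 0 (\<alpha>q - \<alpha>s) (\<beta>q - \<beta>s)"
    by (rule correlation_eq_diff)
next
  fix \<alpha>s \<beta>s \<alpha>s' \<beta>s' \<delta>\<alpha> \<delta>\<beta> :: real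
  show "correlation N lam \<alpha>s \<beta>s (\<alpha>s + \<delta>\<alpha>) (\<beta>s + \<delta>\<beta>) =
      correlation N lam \<alpha>s' \<beta>s' (\<alpha>s' + \<delta>\<alpha>) (\<beta>s' + \<delta>\<beta>)"
    \<comment> \<open>Both sides reduce to the same value at the origin, since the base point
      cancels from the differences.\<close>
    using correlation_eq_diff [of N lam \<alpha>s \<beta>s "\<alpha>s + \<delta>\<alpha>" "\<beta>s + \<delta>\<beta>"]
      correlation_eq_diff [of N lam \<alpha>s' \<beta>s' "\<alpha>s' + \<delta>\<alpha>" "\<beta>s' + \<delta>\<beta>"]
    by simp
qed

end
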